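(* For every $s\in(0,+\infty)$ there is a function in the family of transcendental entire functions described in the context with order of growth $s$. In particular, if $n_k=\lfloor R_k^s\rfloor$ for all $k\ge1$ (with $R$ sufficiently large, depending on $\lambda,N,s$), then the resulting entire function $f$ has order of growth $\rho(f)=s$.
   Context: Construction of the family. Fix a real number $\lambda\ge1$ and an integer $N\ge4$. Let $p_\lambda(z)=\lambda(2z^2-1)$ and let $F_0=p_\lambda^N$ be the $N$-th iterate of $p_\lambda$, a polynomial of degree $m=2^N\ge16$ with leading coefficient $(2\lambda)^{m-1}$. Let $R\ge32$ be a sufficiently large real number, in particular such that $\frac12\le\left|\frac{F_0(z)}{(2\lambda)^{m-1}z^m}\right|\le\frac32$ for all $|z|\ge R$. Put $f_0=F_0$, $R_1=2R$, and recursively for $k\ge1$ choose a positive integer $n_k$ (which may depend on $R_1,\dots,R_k$) and set $$F_k(z)=1-\frac12\left(\frac{z}{R_k}\right)^{n_k},\qquad f_k(z)=f_{k-1}(z)F_k(z),\qquad R_{k+1}=\max_{|z|=2R_k}|f_k(z)|.$$ The standing assumption on the integers is $n_1\ge8$ and $n_{k+1}>n_k$ for all $k\ge1$. The function of the family is the entire function $f(z)=\lim_{k\to\infty}f_k(z)=\prod_{k=0}^\infty F_k(z)$ (the product converges uniformly on compact sets). $\lfloor x\rfloor$ is the largest integer $\le x$. The order of growth is $\rho(f)=\limsup_{z\to\infty}\frac{\log\log|f(z)|}{\log|z|}$ (equivalently $\limsup_{r\to\infty}\frac{\log\log\max_{|z|=r}|f(z)|}{\log r}$). *)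

theory Defs
  imports "HOL-Complex_Analysis.Complex_Analysis"
begin

definition cheb :: "real \<Rightarrow> complex \<Rightarrow> complex" where
  "cheb lam z = of_real lam * (2 * z ^ 2 - 1)"

definition initial_poly :: "real \<Rightarrow> nat \<Rightarrow> complex \<Rightarrow> complex" where
  "initial_poly lam N = cheb lam ^^ N"

definition factor :: "real \<Rightarrow> nat \<Rightarrow> complex \<Rightarrow> complex" where
  "factor r m z = 1 - 1/2 * (z / of_real r) ^ m"

text \<open>
  The radii \<open>R\<^sub>k\<close> and the partial products \<open>f\<^sub>k\<close> depend on each other: \<open>R\<^sub>k\<close> is needed for \<open>f\<^sub>k\<close>,
  and \<open>f\<^sub>k\<close> for \<open>R\<close> with index \<open>k + 1\<close>. The sequence of radii starts at index 1; the value at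
  index 0 is a dummy. The supremum over the circle is a maximum, because the circle is compact.
  The value \<open>n 0\<close> of the exponent sequence is never used.
\<close>
function (sequential)
  radius :: "real \<Rightarrow> nat \<Rightarrow> real \<Rightarrow> (nat \<Rightarrow> nat) \<Rightarrow> nat \<Rightarrow> real" and
  partial_prod :: "real \<Rightarrow> nat \<Rightarrow> real \<Rightarrow> (nat \<Rightarrow> nat) \<Rightarrow> nat \<Rightarrow> complex \<Rightarrow> complex"
where
  "radius lam N R n 0 = 0"
| "radius lam N R n (Suc 0) = 2 * R"
| "radius lam N R n (Suc (Suc k)) =
     (SUP z\<in>sphere 0 (2 * radius lam N R n (Suc k)). norm (partial_prod lam N R n (Suc k) z))"
| "partial_prod lam N R n 0 z = initial_poly lam N z"
| "partial_prod lam N R n (Suc k) z =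
     partial_prod lam N R n k z * factor (radius lam N R n (Suc k)) (n (Suc k)) z"
  by pat_completeness auto
termination
  by (relation "Wellfounded.measure (case_sum (\<lambda>(_, _, _, _, k). 2 * k) (\<lambda>(_, _, _, _, k, _). 2 * k + 1))") auto

definition admissible :: "real \<Rightarrow> nat \<Rightarrow> real \<Rightarrow> (nat \<Rightarrow> nat) \<Rightarrow> bool" where
  "admissible lam N R n \<longleftrightarrow>
     lam \<ge> 1 \<and> N \<ge> 4 \<and> R \<ge> 32 \<and>
     (\<forall>z. norm z \<ge> R \<longrightarrow>
        norm (initial_poly lam N z / (of_real ((2 * lam) ^ (2 ^ N - 1)) * z ^ (2 ^ N))) \<in> {1/2..3/2}) \<and>
     n 1 \<ge> 8 \<and> (\<forall>k\<ge>1. n (k + 1) > n k)"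

text \<open>
  \<open>f\<close> is the member of the family with data \<open>R\<close> and \<open>n\<close>: the partial products converge to \<open>f\<close>
  uniformly on compact sets.
\<close>
definition family_member ::
    "real \<Rightarrow> nat \<Rightarrow> real \<Rightarrow> (nat \<Rightarrow> nat) \<Rightarrow> (complex \<Rightarrow> complex) \<Rightarrow> bool" where
  "family_member lam N R n f \<longleftrightarrow>
     admissible lam N R n \<and>
     (\<forall>K. compact K \<longrightarrow> uniform_limit K (partial_prod lam N R n) f sequentially)"

definition transcendental_entire :: "(complex \<Rightarrow> complex) \<Rightarrow> bool" where
  "transcendental_entire f \<longleftrightarrow> f holomorphic_on UNIV \<and> \<not> (\<exists>p. \<forall>z. f z = poly p z)"

text \<open>
  \<open>log log x\<close> as an extended real, with the usual convention that it is \<open>-\<infinity>\<close> for \<open>x \<le> 1\<close>. The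
  guard is essential: the library's total \<open>ln\<close> satisfies \<open>ln (- x) = ln x\<close>, so that without it
  \<open>ln (ln (norm (f z)))\<close> would be large near the zeros of \<open>f\<close>.
\<close>
definition log_log :: "real \<Rightarrow> ereal" where
  "log_log x = (if x > 1 then ereal (ln (ln x)) else -\<infinity>)"

definition order_of_growth :: "(complex \<Rightarrow> complex) \<Rightarrow> ereal" where
  "order_of_growth f = Limsup at_infinity (\<lambda>z. log_log (norm (f z)) / ereal (ln (norm z)))"

lemma log_log_mono: "x \<le> y \<Longrightarrow> log_log x \<le> log_log y"
  by (auto simp: log_log_def)

text \<open>The equivalent description through the maximum modulus.\<close>
lemma order_of_growth_max_modulus:
  assumes "continuous_on UNIV f"
  shows "order_of_growth f =
    Limsup at_top (\<lambda>r. log_log (SUP z\<in>sphere 0 r. norm (f z)) / ereal (ln r))"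
    (is "_ = Limsup at_top ?g")
proof -
  let ?h = "\<lambda>z. log_log (norm (f z)) / ereal (ln (norm z))"
  have bdd: "bdd_above ((\<lambda>z. norm (f z)) ` sphere 0 r)" for r
    by (intro bounded_imp_bdd_above compact_imp_bounded compact_continuous_image
        continuous_intros continuous_on_subset[OF assms]) auto
  have att: "\<exists>z. norm z = r \<and> (SUP z\<in>sphere 0 r. norm (f z)) = norm (f z)" if "r > 0" for r
  proof -
    have "\<exists>x\<in>sphere 0 r. \<forall>y\<in>sphere 0 r. norm (f y) \<le> norm (f x)"
      using that by (intro continuous_attains_sup continuous_intros continuous_on_subset[OF assms]) auto
    then obtain x where x: "x \<in> sphere 0 r" "\<forall>y\<in>sphere 0 r. norm (f y) \<le> norm (f x)" by auto
    then have "(SUP z\<in>sphere 0 r. norm (f z)) = norm (f x)"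
      by (intro cSup_eq_maximum) auto
    with x show ?thesis by auto
  qed
  have lim: "filterlim norm at_top (at_infinity :: complex filter)"
    by (rule filterlim_norm_at_top)
  show ?thesis
  proof (rule antisym)
    have "?h z \<le> ?g (norm z)" if "norm z \<ge> 2" for z
      using that bdd[of "norm z"]
      by (intro ereal_divide_right_mono log_log_mono cSUP_upper) (auto intro: ln_gt_zero)
    then have "\<forall>\<^sub>F z in at_infinity. ?h z \<le> ?g (norm z)"
      unfolding eventually_at_infinity by blast
    then have "order_of_growth f \<le> Limsup at_infinity (\<lambda>z :: complex. ?g (norm z))"
      unfolding order_of_growth_def by (rule Limsup_mono)
    also have "\<dots> \<le> Limsup (filtermap norm (at_infinity :: complex filter)) ?g"
      by (rule Limsup_filtermap_ge)
    also have "\<dots> \<le> Limsup at_top ?g"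
      unfolding Limsup_le_iff using Limsup_lessD[where f = ?g and F = at_top] lim
      by (auto simp: eventually_filtermap filterlim_iff)
    finally show "order_of_growth f \<le> Limsup at_top ?g" .
  next
    show "Limsup at_top ?g \<le> order_of_growth f"
      unfolding Limsup_le_iff
    proof safe
      fix C assume "order_of_growth f < C"
      then have "\<forall>\<^sub>F z in at_infinity. ?h z < C"
        unfolding order_of_growth_def by (rule Limsup_lessD)
      then obtain b where b: "\<And>z. norm z \<ge> b \<Longrightarrow> ?h z < C"
        unfolding eventually_at_infinity by blast
      have "?g r < C" if "r \<ge> max 1 b" for r
      proof -
        have "r > 0" using that by linarith
        then obtain z where "norm z = r" "(SUP z\<in>sphere 0 r. norm (f z)) = norm (f z)"
          using att[of r] by auto
        then show ?thesis using b[of z] that by simp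
      qed
      then show "\<forall>\<^sub>F r in at_top. ?g r < C"
        unfolding eventually_at_top_linorder by blast
    qed
  qed
qed

end

theory Submission
  imports Defs "HOL-Real_Asymp.Real_Asymp"
begin

text \<open>
  The exponent \<open>n\<^sub>k \<approx> R\<^sub>k\<^sup>s\<close> is the number of zeros of \<open>f\<close> near the circle of radius \<open>R\<^sub>k\<close>, and the
  radii grow so fast that the circles do not interact; the order of growth is therefore read off from
  \<open>log n\<^sub>k / log R\<^sub>k \<longlonglongrightarrow> s\<close>. Both inequalities compare \<open>|f|\<close> with functions \<open>exp (|z| powr \<sigma>)\<close>.

  Lower bound. On the circle \<open>|z| = 2 R\<^sub>k\<close> the \<open>k\<close>-th factor has modulus about \<open>2 ^ n\<^sub>k\<close>, the earlier
  factors and the initial polynomial are large, and the later factors are so close to 1 that their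
  product has modulus at least \<open>1/2\<close>. So \<open>|f z| \<ge> 2 ^ n\<^sub>k\<close> there (\<open>norm_limit_ge\<close>), which beats
  \<open>exp (|z| powr \<sigma>)\<close> for every \<open>\<sigma> < s\<close>. Everything rests on \<open>R\<^sub>k\<^sub>+\<^sub>1 \<ge> R\<^sub>k\<^sup>2\<close>, a consequence of the same
  estimate for the partial products (\<open>norm_partial_prod_ge_if\<close>, \<open>radius_Suc_ge_if\<close>). This growth of the
  radii also gives the locally uniform convergence of the product, because the \<open>k\<close>-th factor differs
  from 1 by at most \<open>|z| / R\<^sub>k\<close> once \<open>|z| \<le> R\<^sub>k\<close>, and it makes the exponents strictly increasing.

  Upper bound. For \<open>m \<ge> \<sigma>\<close> the elementary inequality \<open>1 + x\<^sup>m \<le> exp (C m x powr \<sigma>)\<close> holds for all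
  \<open>x \<ge> 0\<close>, large or small (\<open>norm_factor_le_exp\<close>). Multiplying it over all factors gives
  \<open>|f z| \<le> |F\<^sub>0 z| exp (B |z| powr \<sigma>)\<close> with \<open>B\<close> controlled by \<open>\<Sum>k. n\<^sub>k R\<^sub>k powr (-\<sigma>)\<close>, a series that
  converges for every \<open>\<sigma> > s\<close> since \<open>n\<^sub>k \<le> R\<^sub>k powr s\<close> (\<open>norm_limit_le\<close>). Taking \<open>R\<close> large makes all
  exponents at least \<open>s + 1\<close>, so that no factor has to be treated separately.

  Transcendence is a by-product: a polynomial has order at most 0, whereas \<open>s > 0\<close>.
\<close>

section \<open>Order of growth and comparison with exponentials of powers\<close>

lemma order_of_growth_leI:
  assumes "\<forall>\<^sub>F z in at_infinity. norm (f z) \<le> exp (norm z powr \<sigma>)"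
  shows "order_of_growth f \<le> ereal \<sigma>"
  unfolding order_of_growth_def
proof (rule Limsup_bounded)
  have "\<forall>\<^sub>F z::complex in at_infinity. norm z \<ge> 2"
    unfolding eventually_at_infinity by blast
  with assms show "\<forall>\<^sub>F z in at_infinity. log_log (norm (f z)) / ereal (ln (norm z)) \<le> ereal \<sigma>"
  proof eventually_elim
    case (elim z)
    have l: "ln (norm z) > 0" using elim by (intro ln_gt_zero) auto
    show ?case
    proof (cases "norm (f z) > 1")
      case True
      have "ln (norm (f z)) \<le> ln (exp (norm z powr \<sigma>))"
        using elim(1) True by (subst ln_le_cancel_iff) auto
      then have "ln (norm (f z)) \<le> norm z powr \<sigma>" by simp
      moreover have "ln (norm (f z)) > 0" using True by (rule ln_gt_zero)
      ultimately have "ln (ln (norm (f z))) \<le> ln (norm z powr \<sigma>)"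
        using elim by (subst ln_le_cancel_iff) auto
      then have "ln (ln (norm (f z))) \<le> \<sigma> * ln (norm z)"
        using elim by (simp add: ln_powr split: if_splits)
      then show ?thesis using True l by (simp add: log_log_def divide_simps)
    next
      case False
      then show ?thesis using l by (simp add: log_log_def)
    qed
  qed
qed

text \<open>
  For a lower bound on an upper limit it suffices that \<open>f\<close> is large along one sequence.
\<close>
lemma order_of_growth_geI:
  fixes \<zeta> :: "nat \<Rightarrow> complex"
  assumes lim: "filterlim \<zeta> at_infinity sequentially"
    and ge: "\<forall>\<^sub>F k in sequentially. exp (norm (\<zeta> k) powr \<sigma>) \<le> norm (f (\<zeta> k))"
  shows "ereal \<sigma> \<le> order_of_growth f"
proof (rule ccontr)
  assume "\<not> ereal \<sigma> \<le> order_of_growth f"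
  then have "\<forall>\<^sub>F z in at_infinity. log_log (norm (f z)) / ereal (ln (norm z)) < ereal \<sigma>"
    unfolding order_of_growth_def by (intro Limsup_lessD) auto
  then have "\<forall>\<^sub>F k in sequentially.
      log_log (norm (f (\<zeta> k))) / ereal (ln (norm (\<zeta> k))) < ereal \<sigma>"
    using lim by (rule eventually_compose_filterlim)
  moreover have "\<forall>\<^sub>F z::complex in at_infinity. norm z \<ge> 2"
    unfolding eventually_at_infinity by blast
  then have "\<forall>\<^sub>F k in sequentially. norm (\<zeta> k) \<ge> 2"
    using lim by (rule eventually_compose_filterlim)
  ultimately have "\<forall>\<^sub>F k in sequentially. False"
    using ge
  proof eventually_elim
    case (elim k)
    have l: "ln (norm (\<zeta> k)) > 0" using elim by (intro ln_gt_zero) auto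
    have p: "norm (\<zeta> k) powr \<sigma> > 0" using elim by auto
    then have gt1: "norm (f (\<zeta> k)) > 1" using elim(3) one_less_exp_iff less_le_trans by blast
    have "ln (exp (norm (\<zeta> k) powr \<sigma>)) \<le> ln (norm (f (\<zeta> k)))"
      using elim(3) gt1 by (subst ln_le_cancel_iff) auto
    then have "norm (\<zeta> k) powr \<sigma> \<le> ln (norm (f (\<zeta> k)))" by simp
    then have "ln (norm (\<zeta> k) powr \<sigma>) \<le> ln (ln (norm (f (\<zeta> k))))"
      using p ln_gt_zero[OF gt1] by (subst ln_le_cancel_iff) auto
    then have "\<sigma> * ln (norm (\<zeta> k)) \<le> ln (ln (norm (f (\<zeta> k))))"
      using elim by (simp add: ln_powr split: if_splits)
    then show False using elim(1) gt1 l by (simp add: log_log_def divide_simps)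
  qed
  then show False by simp
qed

lemma order_of_growth_poly_le:
  assumes "\<sigma> > 0"
  shows "order_of_growth (poly p) \<le> ereal \<sigma>"
proof (rule order_of_growth_leI)
  obtain M where M: "\<And>z. M \<le> norm z \<Longrightarrow> norm (poly p z) \<le> 1 * norm z ^ Suc (degree p)"
    unfolding poly_altdef using polyfun_extremal_lemma[of 1 "coeff p" "degree p"] by auto
  have "\<forall>\<^sub>F r in at_top. r ^ Suc (degree p) \<le> exp (r powr \<sigma>)"
    using assms by real_asymp
  then have "\<forall>\<^sub>F z in at_infinity. norm (z::complex) ^ Suc (degree p) \<le> exp (norm z powr \<sigma>)"
    using filterlim_norm_at_top by (rule eventually_compose_filterlim)
  moreover have "\<forall>\<^sub>F z::complex in at_infinity. norm z \<ge> M"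
    unfolding eventually_at_infinity by blast
  ultimately show "\<forall>\<^sub>F z in at_infinity. norm (poly p z) \<le> exp (norm z powr \<sigma>)"
    by eventually_elim (use M in force)
qed

lemma transcendental_entire_if_order_pos:
  assumes "f holomorphic_on UNIV" and "order_of_growth f = ereal s" and "s > 0"
  shows "transcendental_entire f"
  unfolding transcendental_entire_def
proof (intro conjI notI)
  assume "\<exists>p. \<forall>z. f z = poly p z"
  then obtain p where "f = poly p" by blast
  then show False using order_of_growth_poly_le[of "s/2" p] assms by simp
qed (fact assms)

section \<open>The initial polynomial and the factors\<close>

lemma initial_poly_Suc:
  "initial_poly lam (Suc N) z = of_real lam * (2 * initial_poly lam N z ^ 2 - 1)"
  by (simp add: initial_poly_def cheb_def)

lemma holomorphic_initial_poly: "initial_poly lam N holomorphic_on A"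
proof (induction N)
  case 0
  show ?case by (simp add: initial_poly_def id_def)
next
  case (Suc N)
  show ?case unfolding initial_poly_Suc[abs_def] by (intro holomorphic_intros Suc)
qed

text \<open>
  The normalised quotient \<open>q\<^sub>N\<close> satisfies \<open>q\<^sub>N\<^sub>+\<^sub>1 = q\<^sub>N\<^sup>2 - a z ^ (-2m)\<close> with a constant \<open>a\<close> and \<open>m = 2 ^ N\<close>,
  because one more iteration squares the leading coefficient and multiplies it by \<open>2 lam\<close>. So the
  limit 1 is inherited.
\<close>
lemma initial_poly_ratio_tendsto:
  assumes "lam \<ge> 1"
  shows "((\<lambda>z. initial_poly lam N z / (of_real ((2 * lam) ^ (2 ^ N - 1)) * z ^ (2 ^ N))) \<longlongrightarrow> 1)
           at_infinity"
proof (induction N)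
  case 0
  have "\<forall>\<^sub>F z::complex in at_infinity. norm z \<ge> 1"
    unfolding eventually_at_infinity by blast
  then have "\<forall>\<^sub>F z::complex in at_infinity. 1 = z / z"
    by eventually_elim auto
  then show ?case
    by (simp add: initial_poly_def tendsto_eventually eventually_mono)
next
  case (Suc N)
  define c where "c = complex_of_real ((2 * lam) ^ (2 ^ N - 1))"
  define m :: nat where "m = 2 ^ N"
  have m: "m > 0" by (simp add: m_def)
  have c: "c \<noteq> 0" using assms by (simp add: c_def)
  have "filterlim (\<lambda>z::complex. z ^ (2 * m)) at_infinity at_infinity"
    using m by (intro filterlim_power_at_infinity filterlim_ident) auto
  then have inv: "((\<lambda>z::complex. inverse (z ^ (2 * m))) \<longlongrightarrow> 0) at_infinity"
    by (rule filterlim_compose[OF tendsto_inverse_0])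
  have "((\<lambda>z. (initial_poly lam N z / (c * z ^ m)) ^ 2
      - (1 / (2 * c ^ 2)) * inverse (z ^ (2 * m))) \<longlongrightarrow> 1 ^ 2 - 1 / (2 * c ^ 2) * 0) at_infinity"
    by (intro tendsto_diff tendsto_power tendsto_mult_left inv Suc.IH[folded c_def m_def])
  moreover have "\<forall>\<^sub>F z::complex in at_infinity. norm z \<ge> 1"
    unfolding eventually_at_infinity by blast
  then have "\<forall>\<^sub>F z in at_infinity. (initial_poly lam N z / (c * z ^ m)) ^ 2
      - (1 / (2 * c ^ 2)) * inverse (z ^ (2 * m)) =
      initial_poly lam (Suc N) z / (of_real ((2 * lam) ^ (2 ^ Suc N - 1)) * z ^ (2 ^ Suc N))"
  proof eventually_elim
    case (elim z)
    then have z: "z \<noteq> 0" by auto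
    have "(2 * lam) ^ (2 ^ Suc N - 1) = (2 * lam) ^ Suc (2 * (2 ^ N - 1))"
    proof (rule arg_cong[where f = "\<lambda>k. (2 * lam) ^ k"])
      have "(2::nat) ^ N \<ge> 1" by simp
      then show "2 ^ Suc N - 1 = Suc (2 * (2 ^ N - 1))" unfolding power_Suc by linarith
    qed
    also have "\<dots> = 2 * lam * ((2 * lam) ^ (2 ^ N - 1)) ^ 2"
      by (simp only: power_Suc power_mult mult.commute[of 2])
    finally have e: "complex_of_real ((2 * lam) ^ (2 ^ Suc N - 1)) = 2 * of_real lam * c ^ 2"
      by (simp add: c_def)
    have e2: "z ^ (2 ^ Suc N) = (z ^ m) ^ 2"
      by (simp add: m_def power_mult[symmetric] mult.commute)
    have e3: "z ^ (2 * m) = (z ^ m) ^ 2" by (simp add: power_mult[symmetric] mult.commute)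
    show ?case
      unfolding e e2 e3 initial_poly_Suc using c z assms by (simp add: field_simps power2_eq_square)
  qed
  ultimately show ?case by (simp add: Lim_transform_eventually)
qed

lemma eventually_initial_poly_bounds:
  assumes "lam \<ge> 1"
  shows "\<forall>\<^sub>F R in at_top. \<forall>z. norm z \<ge> R \<longrightarrow>
    norm (initial_poly lam N z / (of_real ((2 * lam) ^ (2 ^ N - 1)) * z ^ (2 ^ N))) \<in> {1/2..3/2}"
    (is "\<forall>\<^sub>F R in at_top. \<forall>z. norm z \<ge> R \<longrightarrow> norm (?q z) \<in> _")
proof -
  have "((\<lambda>z. norm (?q z)) \<longlongrightarrow> norm (1::complex)) at_infinity"
    by (intro tendsto_norm initial_poly_ratio_tendsto assms)
  then have "\<forall>\<^sub>F z in at_infinity. dist (norm (?q z)) 1 < 1/2"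
    using tendstoD[of _ "norm (1::complex)" at_infinity "1/2"] by simp
  then have "\<forall>\<^sub>F z in at_infinity. norm (?q z) \<in> {1/2..3/2}"
    by (rule eventually_mono) (auto simp: dist_real_def abs_real_def split: if_splits)
  then obtain b where "\<And>z. norm z \<ge> b \<Longrightarrow> norm (?q z) \<in> {1/2..3/2}"
    unfolding eventually_at_infinity by blast
  then show ?thesis
    unfolding eventually_at_top_linorder by (intro exI[of _ b]) (meson order_trans)
qed

lemma holomorphic_factor: "factor r m holomorphic_on A"
  unfolding factor_def[abs_def] divide_inverse by (intro holomorphic_intros)

text \<open>
  The summand \<open>(z/r)\<^sup>m / 2\<close> has modulus at least \<open>2\<^sup>m / 2\<close>, and subtracting 1 costs at most half of
  that. In particular the factor has modulus at least 1.
\<close>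
lemma norm_factor_ge:
  assumes "m \<ge> 2" and "r > 0" and "norm z \<ge> 2 * r"
  shows "norm (factor r m z) \<ge> 2 ^ m / 4"
proof -
  have "(2::real) ^ 2 \<le> 2 ^ m" using assms by (intro power_increasing) auto
  moreover have "(norm z / r) ^ m \<ge> 2 ^ m"
    using assms by (intro power_mono) (auto simp: field_simps)
  moreover have "norm (1 / 2 * (z / of_real r) ^ m) - norm (1::complex) \<le> norm (factor r m z)"
    unfolding factor_def by (metis norm_minus_commute norm_triangle_ineq2)
  moreover have "norm (1 / 2 * (z / of_real r) ^ m) = (norm z / r) ^ m / 2"
    using assms by (simp add: norm_mult norm_power norm_divide)
  ultimately show ?thesis by simp
qed

lemma norm_factor_minus_1:
  assumes "r > 0"
  shows "norm (factor r m z - 1) = (norm z / r) ^ m / 2"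
  using assms by (simp add: factor_def norm_mult norm_power norm_divide)

lemma norm_factor_minus_1_le:
  assumes "m \<ge> 1" and "r > 0" and "norm z \<le> r"
  shows "norm (factor r m z - 1) \<le> norm z / r"
proof -
  have "(norm z / r) ^ m \<le> (norm z / r) ^ 1"
    using assms by (intro power_decreasing) auto
  moreover have "norm z / r \<ge> 0" using assms by simp
  ultimately show ?thesis
    unfolding norm_factor_minus_1[OF assms(2)] power_one_right by linarith
qed

text \<open>
  With \<open>x = |z| / r\<close> the modulus is at most \<open>1 + x\<^sup>m\<close>. For \<open>x < 1\<close> the hypothesis \<open>m \<ge> \<sigma>\<close> gives
  \<open>x\<^sup>m \<le> x powr \<sigma>\<close>; for \<open>x \<ge> 1\<close> the bound comes from \<open>ln x \<le> x powr \<sigma> / \<sigma>\<close>. The exponent \<open>m\<close> enters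
  only linearly, so the logarithms of these bounds can be summed over all factors of the product.
\<close>
lemma norm_factor_le_exp:
  assumes \<sigma>: "\<sigma> > 0" and m: "m \<ge> 1" "real m \<ge> \<sigma>" and r: "r > 0"
  shows "norm (factor r m z) \<le> exp ((1 + 1 / \<sigma>) * (real m * (norm z / r) powr \<sigma>))"
proof -
  define x where "x = norm z / r"
  have x: "x \<ge> 0" using r by (simp add: x_def)
  have "norm (factor r m z) \<le> norm (factor r m z - 1) + norm (1::complex)"
    by (metis diff_add_cancel norm_triangle_ineq)
  also have "\<dots> \<le> 1 + x ^ m"
    using x r by (simp add: norm_factor_minus_1 x_def)
  also have "\<dots> \<le> exp ((1 + 1 / \<sigma>) * (real m * x powr \<sigma>))"
  proof (cases "x \<ge> 1")
    case True
    have p: "x powr \<sigma> \<ge> 1" using True \<sigma> by (intro ge_one_powr_ge_zero) auto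
    have xm: "x ^ m \<ge> 1" using True by simp
    have "1 + x ^ m \<le> 2 * x ^ m" using xm by simp
    also have "\<dots> \<le> exp 1 * x ^ m"
      using xm exp_ge_add_one_self[of 1] by (intro mult_right_mono) auto
    also have "exp 1 * x ^ m = exp (1 + real m * ln x)"
      using True by (simp add: exp_add exp_of_nat_mult)
    also have "\<dots> \<le> exp (real m * x powr \<sigma> + real m * (x powr \<sigma> / \<sigma>))"
    proof -
      have "1 * 1 \<le> real m * x powr \<sigma>" using m p by (intro mult_mono) auto
      moreover have "real m * ln x \<le> real m * (x powr \<sigma> / \<sigma>)"
        using True \<sigma> by (intro mult_left_mono ln_powr_bound) auto
      ultimately show ?thesis by simp
    qed
    finally show ?thesis by (simp add: algebra_simps)
  next
    case False
    have "x ^ m \<le> 1 * (1 * x powr \<sigma>)"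
    proof (cases "x = 0")
      case False
      then have "x ^ m = x powr real m" using x by (simp add: powr_realpow)
      also have "\<dots> \<le> x powr \<sigma>"
        using \<open>\<not> x \<ge> 1\<close> False x m by (intro powr_mono') auto
      finally show ?thesis by simp
    qed (use m in \<open>simp add: power_0_left\<close>)
    also have "\<dots> \<le> (1 + 1 / \<sigma>) * (real m * x powr \<sigma>)"
      using m \<sigma> by (intro mult_mono) auto
    finally show ?thesis
      using exp_ge_add_one_self[of "(1 + 1 / \<sigma>) * (real m * x powr \<sigma>)"] by linarith
  qed
  finally show ?thesis by (simp add: x_def)
qed

section \<open>Growth of the radii and convergence of the product\<close>

text \<open>
  The bound on the exponents is conditional on a lower bound for the radius. For exponents that are
  computed from the radii this is all that is available at the outset; \<open>radius_bounds\<close> discharges the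
  condition by an induction that runs through the radii and the exponents together.
\<close>
locale lacunary_family =
  fixes lam R :: real and N :: nat and n :: "nat \<Rightarrow> nat"
  assumes lam_ge: "lam \<ge> 1" and N_ge: "N \<ge> 4" and R_ge: "R \<ge> 32"
    and initial_poly_ratio_bounds: "\<And>z. norm z \<ge> R \<Longrightarrow>
      norm (initial_poly lam N z / (of_real ((2 * lam) ^ (2 ^ N - 1)) * z ^ (2 ^ N))) \<in> {1/2..3/2}"
    and exponent_ge_if: "\<And>k. k \<ge> 1 \<Longrightarrow> radius lam N R n k \<ge> 2 * R \<Longrightarrow> n k \<ge> 2"
begin

abbreviation "\<rho> \<equiv> radius lam N R n"
abbreviation "P \<equiv> partial_prod lam N R n"
abbreviation "F \<equiv> (\<lambda>z. lim (\<lambda>k. P k z))"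

lemma initial_poly_bounds:
  assumes "norm z \<ge> R"
  shows "norm (initial_poly lam N z) \<ge> norm z ^ 16 / 2"
    and "norm (initial_poly lam N z) \<le> 3 / 2 * (2 * lam) ^ (2 ^ N - 1) * norm z ^ (2 ^ N)"
proof -
  define c where "c = (2 * lam) ^ (2 ^ N - 1)"
  have c: "c \<ge> 1" unfolding c_def using lam_ge by (intro one_le_power) auto
  have z: "norm z \<ge> 1" using assms R_ge by simp
  then have z0: "norm z ^ (2 ^ N) > 0" by (intro zero_less_power) linarith
  have "norm (initial_poly lam N z / (of_real c * z ^ (2 ^ N))) \<in> {1/2..3/2}"
    unfolding c_def by (rule initial_poly_ratio_bounds) fact
  then have *: "norm (initial_poly lam N z) / (c * norm z ^ (2 ^ N)) \<in> {1/2..3/2}"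
    using c by (simp add: norm_divide norm_mult norm_power)
  then show "norm (initial_poly lam N z) \<le> 3 / 2 * (2 * lam) ^ (2 ^ N - 1) * norm z ^ (2 ^ N)"
    unfolding c_def[symmetric] using c z0 by (simp add: field_simps)
  have "(2::nat) ^ 4 \<le> 2 ^ N" using N_ge by (intro power_increasing) auto
  then have "1 * norm z ^ 16 \<le> c * norm z ^ (2 ^ N)"
    using z c by (intro mult_mono power_increasing) auto
  then show "norm (initial_poly lam N z) \<ge> norm z ^ 16 / 2"
    using * c z0 by (simp add: field_simps)
qed

lemma partial_prod_eq: "P k z = initial_poly lam N z * (\<Prod>j=1..k. factor (\<rho> j) (n j) z)"
  by (induction k) (simp_all add: prod.nat_ivl_Suc')

lemma holomorphic_partial_prod: "P k holomorphic_on UNIV"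
proof -
  have "(\<lambda>z. initial_poly lam N z * (\<Prod>j=1..k. factor (\<rho> j) (n j) z)) holomorphic_on UNIV"
    by (intro holomorphic_intros holomorphic_initial_poly holomorphic_factor)
  moreover have "(\<lambda>z. initial_poly lam N z * (\<Prod>j=1..k. factor (\<rho> j) (n j) z)) = P k"
    by (simp add: partial_prod_eq fun_eq_iff)
  ultimately show ?thesis by simp
qed

text \<open>
  The last factor contributes \<open>2 ^ n k / 4\<close> and the earlier ones at least 1. The initial polynomial has
  degree at least 16, so on the large circle it exceeds \<open>4 * \<rho> k ^ 2\<close> by far, which absorbs the
  constant and leaves the surplus \<open>\<rho> k ^ 2\<close> that drives the growth of the radii.
\<close>
lemma norm_partial_prod_ge_if:
  assumes k: "k \<ge> 1" and radii: "\<And>j. j \<in> {1..k} \<Longrightarrow> 2 * R \<le> \<rho> j \<and> \<rho> j \<le> \<rho> k"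
    and z: "norm z = 2 * \<rho> k"
  shows "norm (P k z) \<ge> \<rho> k ^ 2 * 2 ^ n k"
proof -
  have rk: "\<rho> k \<ge> 64" using radii[of k] k R_ge by auto
  have factors: "norm (factor (\<rho> j) (n j) z) \<ge> 2 ^ n j / 4" and two: "(2::real) ^ n j \<ge> 4"
    if "j \<in> {1..k}" for j
  proof -
    have n2: "n j \<ge> 2" using that radii[OF that] by (intro exponent_ge_if) auto
    then show "norm (factor (\<rho> j) (n j) z) \<ge> 2 ^ n j / 4"
      using radii[OF that] R_ge z by (intro norm_factor_ge) auto
    have "(2::real) ^ 2 \<le> 2 ^ n j" using n2 by (intro power_increasing) auto
    then show "(2::real) ^ n j \<ge> 4" by simp
  qed
  have "(\<Prod>j=1..<k. norm (factor (\<rho> j) (n j) z)) \<ge> 1"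
  proof (rule prod_ge_1)
    fix j assume "j \<in> {1..<k}"
    then have "j \<in> {1..k}" by simp
    from factors[OF this] two[OF this] show "1 \<le> norm (factor (\<rho> j) (n j) z)" by linarith
  qed
  then have "1 * (2 ^ n k / 4) \<le>
      (\<Prod>j=1..<k. norm (factor (\<rho> j) (n j) z)) * norm (factor (\<rho> k) (n k) z)"
    using factors[of k] k by (intro mult_mono) auto
  also have "\<dots> = norm (\<Prod>j=1..k. factor (\<rho> j) (n j) z)"
    using k by (cases k) (simp_all add: prod_norm norm_mult atLeastLessThanSuc_atLeastAtMost prod.nat_ivl_Suc')
  finally have 1: "2 ^ n k / 4 \<le> norm (\<Prod>j=1..k. factor (\<rho> j) (n j) z)" by simp
  have "4 * \<rho> k ^ 2 \<le> (2 * \<rho> k) ^ 2 * (2 * \<rho> k) ^ 14 / 2"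
  proof -
    have "1 * 2 \<le> (2 * \<rho> k) ^ 13 * (2 * \<rho> k) ^ 1"
      using rk by (intro mult_mono one_le_power) auto
    then have "(2 * \<rho> k) ^ 2 * 2 \<le> (2 * \<rho> k) ^ 2 * (2 * \<rho> k) ^ 14"
      by (intro mult_left_mono) (simp_all only: power_add[symmetric], simp_all)
    moreover have "(2 * \<rho> k) ^ 2 = 4 * \<rho> k ^ 2" by (simp add: power_mult_distrib)
    ultimately show ?thesis by linarith
  qed
  also have "\<dots> = norm z ^ 16 / 2" unfolding z power_add[symmetric] by simp
  also have "\<dots> \<le> norm (initial_poly lam N z)"
    using rk radii[of k] k R_ge z by (intro initial_poly_bounds) auto
  finally have "4 * \<rho> k ^ 2 * (2 ^ n k / 4) \<le> norm (P k z)"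
    unfolding partial_prod_eq norm_mult using 1 by (intro mult_mono) auto
  then show ?thesis by simp
qed

lemma radius_Suc_ge_if:
  assumes k: "k \<ge> 1" and radii: "\<And>j. j \<in> {1..k} \<Longrightarrow> 2 * R \<le> \<rho> j \<and> \<rho> j \<le> \<rho> k"
  shows "\<rho> (Suc k) \<ge> \<rho> k ^ 2"
proof -
  have rk: "\<rho> k \<ge> 64" using radii[of k] k R_ge by auto
  define z where "z = complex_of_real (2 * \<rho> k)"
  have z: "norm z = 2 * \<rho> k" using rk by (simp add: z_def)
  have "continuous_on (sphere 0 (2 * \<rho> k)) (P k)"
    using holomorphic_on_imp_continuous_on[OF holomorphic_partial_prod] continuous_on_subset by blast
  then have "bdd_above ((\<lambda>z. norm (P k z)) ` sphere 0 (2 * \<rho> k))"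
    by (intro bounded_imp_bdd_above compact_imp_bounded compact_continuous_image continuous_intros)
       auto
  then have "norm (P k z) \<le> (SUP z\<in>sphere 0 (2 * \<rho> k). norm (P k z))"
    using z by (intro cSUP_upper) auto
  also have "\<dots> = \<rho> (Suc k)" using k by (cases k) auto
  finally have "\<rho> k ^ 2 * 2 ^ n k \<le> \<rho> (Suc k)"
    using norm_partial_prod_ge_if[OF k radii z] by linarith
  moreover have "\<rho> k ^ 2 * 1 \<le> \<rho> k ^ 2 * 2 ^ n k" by (intro mult_left_mono) auto
  ultimately show ?thesis by linarith
qed

lemma radius_bounds:
  assumes "k \<ge> 1"
  shows "\<forall>j\<in>{1..k}. 2 * R \<le> \<rho> j \<and> \<rho> j \<le> \<rho> k"
  using assms
proof (induction k rule: nat_induct_at_least)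
  case base
  show ?case by simp
next
  case (Suc k)
  have "k \<in> {1..k}" using Suc.hyps by simp
  then have "\<rho> k \<ge> 2 * R" using Suc.IH by blast
  then have rk: "\<rho> k \<ge> 64" "\<rho> k \<ge> 2 * R" using R_ge by linarith+
  have "\<rho> k * 1 \<le> \<rho> k ^ 2" unfolding power2_eq_square using rk by (intro mult_left_mono) auto
  also have "\<dots> \<le> \<rho> (Suc k)" using Suc.IH Suc.hyps by (intro radius_Suc_ge_if) blast+
  finally have step: "\<rho> k \<le> \<rho> (Suc k)" by simp
  show ?case
  proof
    fix j assume "j \<in> {1..Suc k}"
    then consider "j = Suc k" | "j \<in> {1..k}" by fastforce
    then show "2 * R \<le> \<rho> j \<and> \<rho> j \<le> \<rho> (Suc k)"
    proof cases
      case 1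
      then show ?thesis using step rk by simp
    next
      case 2
      then have "2 * R \<le> \<rho> j \<and> \<rho> j \<le> \<rho> k" using Suc.IH by blast
      then show ?thesis using step by linarith
    qed
  qed
qed

lemma radius_ge: "k \<ge> 1 \<Longrightarrow> \<rho> k \<ge> 2 * R"
  using radius_bounds[of k] by auto

lemma radius_pos: "k \<ge> 1 \<Longrightarrow> \<rho> k > 0"
  using radius_ge[of k] R_ge by linarith

lemma exponent_ge: "k \<ge> 1 \<Longrightarrow> n k \<ge> 2"
  by (intro exponent_ge_if radius_ge)

lemma norm_partial_prod_ge:
  assumes "k \<ge> 1" and "norm z = 2 * \<rho> k"
  shows "norm (P k z) \<ge> \<rho> k ^ 2 * 2 ^ n k"
  using assms radius_bounds by (intro norm_partial_prod_ge_if) auto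

lemma radius_Suc_ge: "k \<ge> 1 \<Longrightarrow> \<rho> (Suc k) \<ge> \<rho> k ^ 2"
  using radius_bounds by (intro radius_Suc_ge_if) auto

lemma radius_add_ge:
  assumes "k \<ge> 1"
  shows "\<rho> (k + d) \<ge> 4 ^ d * \<rho> k"
proof (induction d)
  case (Suc d)
  have "4 * (4 ^ d * \<rho> k) \<le> \<rho> (k + d) * \<rho> (k + d)"
  proof (rule mult_mono[OF _ Suc])
    have pos: "\<rho> (k + d) \<ge> 2 * R" by (rule radius_ge) (use assms in simp)
    then show "4 \<le> \<rho> (k + d)" "0 \<le> \<rho> (k + d)" using R_ge by linarith+
    show "0 \<le> 4 ^ d * \<rho> k" using radius_pos[OF assms] by simp
  qed
  also have "\<dots> \<le> \<rho> (k + Suc d)"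
    using radius_Suc_ge[of "k + d"] assms by (simp add: power2_eq_square)
  finally show ?case by (simp add: mult.assoc)
qed simp

lemma radius_Suc_ge_power: "\<rho> (Suc j) \<ge> 4 ^ j"
proof -
  have "4 ^ j * 1 \<le> 4 ^ j * \<rho> 1" using R_ge by (intro mult_left_mono) auto
  also have "\<dots> \<le> \<rho> (Suc j)" using radius_add_ge[of 1 j] by simp
  finally show ?thesis by simp
qed

text \<open>
  On a compact set all factors with sufficiently large index satisfy \<open>|factor - 1| \<le> |z| / \<rho> i\<close>, and
  the radii grow at least geometrically, so the Weierstrass test applies.
\<close>
lemma uniform_limit_partial_prod:
  assumes K: "compact K"
  shows "uniform_limit K P F sequentially"
proof -
  \<comment> \<open>The initial polynomial is treated as factor number 0, so that the partial products are those of
    a single sequence of functions.\<close>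
  define q where "q i = (case i of 0 \<Rightarrow> initial_poly lam N | Suc j \<Rightarrow> factor (\<rho> (Suc j)) (n (Suc j)))"
    for i
  have P_eq: "P k = (\<lambda>z. \<Prod>i<Suc k. q i z)" for k
    by (induction k) (simp_all add: q_def fun_eq_iff)
  obtain b where b: "\<And>z. z \<in> K \<Longrightarrow> norm z \<le> b"
    using compact_imp_bounded[OF K] unfolding bounded_iff by blast
  define B where "B = max 1 b"
  have B: "\<And>z. z \<in> K \<Longrightarrow> norm z \<le> B" and B1: "B \<ge> 1"
    using b by (auto simp: B_def intro: max.coboundedI2)
  have "uniformly_convergent_on K (\<lambda>k z. \<Prod>i<k. q i z)"
  proof (rule uniformly_convergent_on_prod'[OF _ K])
    show "continuous_on K (q i)" for i
    proof (cases i)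
      case 0
      then show ?thesis
        using holomorphic_on_imp_continuous_on[OF holomorphic_initial_poly] by (simp add: q_def)
    next
      case (Suc j)
      then show ?thesis
        using holomorphic_on_imp_continuous_on[OF holomorphic_factor] by (simp add: q_def)
    qed
    show "uniformly_convergent_on K (\<lambda>k z. \<Sum>i<k. norm (q i z - 1))"
    proof (rule Weierstrass_m_test'_ev)
      show "summable (\<lambda>i. 4 * B * (1 / 4) ^ i)"
        using summable_mult[OF summable_geometric[of "1 / 4 :: real"], of "4 * B"] by simp
      have "\<forall>\<^sub>F i in sequentially. 4 * B * (1 / 4) ^ i \<le> 1" using B1 by real_asymp
      moreover have "\<forall>\<^sub>F i in sequentially. i \<ge> 1" by (rule eventually_ge_at_top)
      ultimately show "\<forall>\<^sub>F i in sequentially. \<forall>z\<in>K. norm (norm (q i z - 1)) \<le> 4 * B * (1 / 4) ^ i"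
      proof eventually_elim
        case (elim i)
        then obtain j where i: "i = Suc j" by (cases i) auto
        show ?case
        proof
          fix z assume "z \<in> K"
          have pos: "\<rho> i > 0" using radius_pos i by auto
          have "norm z / \<rho> i \<le> B / 4 ^ j"
            using B[OF \<open>z \<in> K\<close>] B1 radius_Suc_ge_power[of j] i by (intro frac_le) auto
          also have "\<dots> = 4 * B * (1 / 4) ^ i" by (simp add: i power_one_over field_simps)
          finally have le: "norm z / \<rho> i \<le> 4 * B * (1 / 4) ^ i" .
          then have "norm z / \<rho> i \<le> 1" using elim by linarith
          then have "norm z \<le> \<rho> i" using pos by (simp add: divide_le_eq)
          then have "norm (factor (\<rho> i) (n i) z - 1) \<le> norm z / \<rho> i"
            using exponent_ge[of i] i pos by (intro norm_factor_minus_1_le) auto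
          then show "norm (norm (q i z - 1)) \<le> 4 * B * (1 / 4) ^ i" using le i by (simp add: q_def)
        qed
      qed
    qed
  qed
  then obtain g where "uniform_limit K (\<lambda>k z. \<Prod>i<k. q i z) g sequentially"
    unfolding uniformly_convergent_on_def by blast
  from filterlim_compose[OF this filterlim_Suc] have "uniform_limit K P g sequentially"
    by (simp add: P_eq[abs_def])
  then show ?thesis
    unfolding uniformly_convergent_uniform_limit_iff[symmetric] uniformly_convergent_on_def by blast
qed

lemma partial_prod_tendsto: "(\<lambda>k. P k z) \<longlonglongrightarrow> F z"
  using tendsto_uniform_limitI[OF uniform_limit_partial_prod[of "{z}"]] by simp

lemma holomorphic_limit: "F holomorphic_on UNIV"
proof (rule holomorphic_uniform_sequence)
  show "\<exists>d>0. cball x d \<subseteq> UNIV \<and> uniform_limit (cball x d) P F sequentially" for x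
    by (intro exI[of _ 1] conjI uniform_limit_partial_prod) auto
qed (auto intro: holomorphic_partial_prod)

text \<open>
  On the circle \<open>|z| = 2 \<rho> k\<close> the factor with index \<open>k + d + 1\<close> differs from 1 by at most
  \<open>(1/2) ^ (d + 2)\<close>, hence the factors after the \<open>k\<close>-th one multiply to a modulus of at least \<open>1/2\<close>.
  The lost factor 2 is covered by the surplus \<open>\<rho> k ^ 2\<close> in the bound for the partial product.
\<close>
lemma norm_limit_ge:
  assumes k: "k \<ge> 1" and z: "norm z = 2 * \<rho> k"
  shows "norm (F z) \<ge> 2 ^ n k"
proof -
  define A where "A = norm (P k z)"
  have A: "A \<ge> \<rho> k ^ 2 * 2 ^ n k" unfolding A_def by (rule norm_partial_prod_ge) fact+
  have rk: "\<rho> k \<ge> 64" using radius_ge[OF k] R_ge by linarith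
  \<comment> \<open>The summand \<open>(1/2) ^ (d + 1)\<close> strengthens the induction: with \<open>x = (1/2) ^ (d + 1)\<close> one has
    \<open>(1/2 + x) (1 - x/2) \<ge> 1/2 + x/2\<close>, since \<open>x \<le> 1/2\<close>.\<close>
  have step: "norm (P (k + d) z) \<ge> A * (1 / 2 + (1 / 2) ^ Suc d)" for d
  proof (induction d)
    case 0
    show ?case by (simp add: A_def)
  next
    case (Suc d)
    let ?i = "k + Suc d" and ?x = "(1 / 2 :: real) ^ Suc d"
    have pos: "\<rho> ?i > 0" by (rule radius_pos) simp
    have grow: "4 ^ Suc d * \<rho> k \<le> \<rho> ?i" by (rule radius_add_ge) fact
    have x: "?x \<ge> 0" "?x \<le> 1 / 2" by (simp_all add: power_le_one)
    have small: "norm (factor (\<rho> ?i) (n ?i) z - 1) \<le> ?x / 2"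
    proof -
      have "(norm z / \<rho> ?i) \<le> 2 * \<rho> k / (4 ^ Suc d * \<rho> k)"
        unfolding z using grow rk by (intro frac_le) auto
      also have "\<dots> = 2 * ?x ^ 2"
        using rk by (simp add: power_one_over power2_eq_square field_simps flip: power_mult_distrib)
      finally have le: "norm z / \<rho> ?i \<le> 2 * ?x ^ 2" .
      have "2 * ?x ^ 2 \<le> ?x"
        using x mult_left_mono[of ?x "1/2" ?x] by (simp add: power2_eq_square)
      with le have le': "norm z / \<rho> ?i \<le> ?x" by linarith
      have "(norm z / \<rho> ?i) ^ n ?i \<le> (norm z / \<rho> ?i) ^ 1"
      proof (rule power_decreasing)
        show "1 \<le> n ?i" using exponent_ge[of ?i] by simp
        show "0 \<le> norm z / \<rho> ?i" using pos by simp
        show "norm z / \<rho> ?i \<le> 1" using le' x by linarith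
      qed
      then show ?thesis
        using le' unfolding norm_factor_minus_1[OF pos] power_one_right by linarith
    qed
    have "1 - ?x / 2 \<le> norm (factor (\<rho> ?i) (n ?i) z)"
      using small norm_triangle_ineq2[of 1 "1 - factor (\<rho> ?i) (n ?i) z"]
      unfolding norm_minus_commute[of "factor (\<rho> ?i) (n ?i) z" 1] by simp
    then have "A * (1 / 2 + ?x) * (1 - ?x / 2) \<le> norm (P (k + d) z) * norm (factor (\<rho> ?i) (n ?i) z)"
      using Suc x by (intro mult_mono) auto
    also have "\<dots> = norm (P ?i z)" by (simp add: norm_mult)
    finally have 1: "A * (1 / 2 + ?x) * (1 - ?x / 2) \<le> norm (P ?i z)" .
    have "1 / 2 + ?x / 2 \<le> (1 / 2 + ?x) * (1 - ?x / 2)"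
      using x mult_left_mono[of ?x "1/2" ?x] by (simp add: field_simps)
    then have "A * (1 / 2 + ?x / 2) \<le> A * ((1 / 2 + ?x) * (1 - ?x / 2))"
      unfolding A_def by (intro mult_left_mono) auto
    with 1 show ?case by (simp add: mult.assoc)
  qed
  have "norm (F z) \<ge> A / 2"
  proof (rule tendsto_lowerbound)
    show "(\<lambda>k. norm (P k z)) \<longlonglongrightarrow> norm (F z)" by (intro tendsto_norm partial_prod_tendsto)
    show "\<forall>\<^sub>F i in sequentially. A / 2 \<le> norm (P i z)"
      using eventually_ge_at_top[of k]
    proof eventually_elim
      case (elim i)
      have "A * (1 / 2) \<le> A * (1 / 2 + (1 / 2) ^ Suc (i - k))"
        unfolding A_def by (intro mult_left_mono) auto
      then show ?case using step[of "i - k"] elim by simp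
    qed
  qed simp
  moreover have "2 * 2 ^ n k \<le> \<rho> k ^ 2 * 2 ^ n k"
  proof (rule mult_right_mono)
    have "2 * 1 \<le> \<rho> k * \<rho> k" using rk by (intro mult_mono) auto
    then show "2 \<le> \<rho> k ^ 2" by (simp add: power2_eq_square)
  qed simp
  ultimately show ?thesis using A by linarith
qed

lemma filterlim_radius: "filterlim \<rho> at_top sequentially"
proof -
  have "filterlim (\<lambda>j. \<rho> (Suc j)) at_top sequentially"
  proof (rule filterlim_at_top_mono)
    show "filterlim real at_top sequentially" by (rule filterlim_real_sequentially)
    have "real j \<le> 4 ^ j" for j
    proof (induction j)
      case (Suc j)
      have "(1::real) \<le> 4 ^ j" by simp
      then show ?case unfolding of_nat_Suc power_Suc using Suc by linarith
    qed simp
    then have "real j \<le> \<rho> (Suc j)" for j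
      using radius_Suc_ge_power[of j] by (rule order_trans)
    then show "\<forall>\<^sub>F j in sequentially. real j \<le> \<rho> (Suc j)" by simp
  qed
  then show ?thesis by (simp add: filterlim_sequentially_Suc)
qed

end

section \<open>Exponents given by powers of the radii\<close>

text \<open>
  The constant \<open>s + 9\<close> makes every exponent at least \<open>s + 8\<close> after rounding down. This exceeds both the
  lower bound 8 required of the first exponent and every \<open>\<sigma> \<le> s + 1\<close> used in the upper bound for the
  limit.
\<close>
locale power_family =
  fixes lam R s :: real and N :: nat and n :: "nat \<Rightarrow> nat"
  assumes lam_ge: "lam \<ge> 1" and N_ge: "N \<ge> 4" and R_ge: "R \<ge> 32"
    and initial_poly_ratio_bounds: "\<And>z. norm z \<ge> R \<Longrightarrow>
      norm (initial_poly lam N z / (of_real ((2 * lam) ^ (2 ^ N - 1)) * z ^ (2 ^ N))) \<in> {1/2..3/2}"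
    and s_pos: "s > 0" and R_large: "(2 * R) powr s \<ge> s + 9"
    and exponent_eq: "\<And>k. k \<ge> 1 \<Longrightarrow> int (n k) = \<lfloor>radius lam N R n k powr s\<rfloor>"
begin

lemma exponent_bounds:
  assumes "k \<ge> 1"
  shows "real (n k) \<le> radius lam N R n k powr s" and "radius lam N R n k powr s - 1 < real (n k)"
proof -
  have "real (n k) = of_int \<lfloor>radius lam N R n k powr s\<rfloor>"
    using exponent_eq[OF assms] by (metis of_int_of_nat_eq)
  then show "real (n k) \<le> radius lam N R n k powr s" "radius lam N R n k powr s - 1 < real (n k)"
    by linarith+
qed

lemma exponent_ge_if_radius:
  assumes "k \<ge> 1" and "radius lam N R n k \<ge> 2 * R"
  shows "real (n k) \<ge> s + 8"
proof -
  have "(2 * R) powr s \<le> radius lam N R n k powr s"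
    using assms s_pos R_ge by (intro powr_mono2) auto
  then show ?thesis using exponent_bounds[OF assms(1)] R_large by linarith
qed

sublocale lacunary_family lam R N n
proof
  show "n k \<ge> 2" if "k \<ge> 1" "radius lam N R n k \<ge> 2 * R" for k
    using exponent_ge_if_radius[OF that] s_pos by linarith
qed (use lam_ge N_ge R_ge initial_poly_ratio_bounds in auto)

lemma exponent_ge_large: "k \<ge> 1 \<Longrightarrow> real (n k) \<ge> s + 8"
  by (intro exponent_ge_if_radius radius_ge)

text \<open>
  Since \<open>\<rho> (Suc k) \<ge> \<rho> k ^ 2\<close>, the power \<open>\<rho> k powr s \<ge> 9\<close> is at least squared from one index to the
  next. It thus grows by more than 1, so that rounding down keeps the inequality strict.
\<close>
lemma exponent_less_Suc:
  assumes "k \<ge> 1"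
  shows "n k < n (Suc k)"
proof -
  have p: "\<rho> k powr s \<ge> 9"
    using exponent_ge_large[OF assms] exponent_bounds(1)[OF assms] s_pos
      powr_mono2[of s "2 * R" "\<rho> k"] radius_ge[OF assms] R_ge R_large by auto
  have "\<rho> k powr s + 1 \<le> \<rho> k powr s * \<rho> k powr s"
    using mult_left_mono[OF p, of "\<rho> k powr s"] p by linarith
  also have "\<dots> = (\<rho> k ^ 2) powr s"
    using radius_pos[OF assms] by (simp add: powr_mult power2_eq_square)
  also have "\<dots> \<le> \<rho> (Suc k) powr s"
    using radius_Suc_ge[OF assms] s_pos by (intro powr_mono2) auto
  finally have "real (n k) < real (n (Suc k))"
    using exponent_bounds(1)[OF assms] exponent_bounds(2)[of "Suc k"] by simp
  then show ?thesis by simp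
qed

lemma family_member_limit: "family_member lam N R n F"
proof -
  have "real (n 1) \<ge> 8" using exponent_ge_large[of 1] s_pos by simp
  then have "admissible lam N R n"
    unfolding admissible_def
    using lam_ge N_ge R_ge initial_poly_ratio_bounds exponent_less_Suc by auto
  then show ?thesis
    unfolding family_member_def using uniform_limit_partial_prod by blast
qed

text \<open>
  The bounds \<open>norm_factor_le_exp\<close> multiply to the exponential of \<open>|z| powr \<sigma>\<close> times a partial sum of
  \<open>\<Sum>k. n k * \<rho> k powr (-\<sigma>)\<close>. That series is dominated by a geometric one: \<open>n k \<le> \<rho> k powr s\<close>, and
  \<open>\<rho> k powr (s - \<sigma>)\<close> decays because the radii grow geometrically.
\<close>
lemma norm_limit_le:
  assumes \<sigma>: "s < \<sigma>" "\<sigma> \<le> s + 1"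
  obtains B where "B > 0" and "\<And>z. norm (F z) \<le> norm (initial_poly lam N z) * exp (B * norm z powr \<sigma>)"
proof -
  define a where "a j = (4 powr (s - \<sigma>)) ^ j" for j :: nat
  have "summable a"
    unfolding a_def
  proof (rule summable_geometric)
    have "4 powr (s - \<sigma>) < (4::real) powr 0" using \<sigma> by (intro powr_less_mono) auto
    then show "norm ((4::real) powr (s - \<sigma>)) < 1" by simp
  qed
  have a: "real (n (Suc j)) * \<rho> (Suc j) powr (- \<sigma>) \<le> a j" for j
  proof -
    have "real (n (Suc j)) * \<rho> (Suc j) powr (- \<sigma>) \<le> \<rho> (Suc j) powr s * \<rho> (Suc j) powr (- \<sigma>)"
      by (intro mult_right_mono exponent_bounds) auto
    also have "\<dots> = \<rho> (Suc j) powr (s - \<sigma>)" by (simp flip: powr_add)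
    also have "\<dots> \<le> (4 ^ j) powr (s - \<sigma>)"
      using \<sigma> radius_Suc_ge_power[of j] by (intro powr_mono2') auto
    also have "\<dots> = a j"
      unfolding a_def by (simp add: powr_powr mult.commute flip: powr_realpow)
    finally show ?thesis .
  qed
  define C where "C = 1 + 1 / \<sigma>"
  have C: "C \<ge> 1" using \<sigma> s_pos by (simp add: C_def)
  have fin: "(\<Sum>j<k. a j) \<le> suminf a" for k
    by (rule sum_le_suminf[OF \<open>summable a\<close>]) (simp_all add: a_def)
  have partial: "norm (P k z) \<le> norm (initial_poly lam N z) * exp (C * suminf a * norm z powr \<sigma>)" for k z
  proof -
    have "norm (\<Prod>j=1..k. factor (\<rho> j) (n j) z) = (\<Prod>j<k. norm (factor (\<rho> (Suc j)) (n (Suc j)) z))"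
      by (simp add: prod.atLeast1_atMost_eq prod_norm)
    also have "\<dots> \<le> (\<Prod>j<k. exp (C * norm z powr \<sigma> * a j))"
    proof (rule prod_mono, safe)
      fix j
      let ?r = "\<rho> (Suc j)"
      have r: "?r > 0" by (rule radius_pos) simp
      have "norm (factor ?r (n (Suc j)) z) \<le> exp (C * (real (n (Suc j)) * (norm z / ?r) powr \<sigma>))"
        unfolding C_def using \<sigma> s_pos exponent_ge_large[of "Suc j"] exponent_ge[of "Suc j"] r
        by (intro norm_factor_le_exp) auto
      also have "real (n (Suc j)) * (norm z / ?r) powr \<sigma> =
          norm z powr \<sigma> * (real (n (Suc j)) * ?r powr (- \<sigma>))"
        using r by (simp add: powr_divide powr_minus_divide)
      also have "exp (C * \<dots>) \<le> exp (C * (norm z powr \<sigma> * a j))"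
        unfolding exp_le_cancel_iff using C a[of j] by (intro mult_left_mono) auto
      finally show "norm (factor ?r (n (Suc j)) z) \<le> exp (C * norm z powr \<sigma> * a j)"
        by (simp add: mult.assoc)
    qed simp
    also have "\<dots> = exp (C * norm z powr \<sigma> * (\<Sum>j<k. a j))"
      by (simp add: exp_sum sum_distrib_left)
    also have "\<dots> \<le> exp (C * norm z powr \<sigma> * suminf a)"
      unfolding exp_le_cancel_iff using C fin by (intro mult_left_mono) auto
    finally have "norm (\<Prod>j=1..k. factor (\<rho> j) (n j) z) \<le> exp (C * suminf a * norm z powr \<sigma>)"
      by (simp add: mult_ac)
    then show ?thesis unfolding partial_prod_eq norm_mult by (intro mult_left_mono) auto
  qed
  show thesis
  proof
    have "a 0 \<le> suminf a" using fin[of 1] by simp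
    then show "C * suminf a > 0" using C by (simp add: a_def)
    show "norm (F z) \<le> norm (initial_poly lam N z) * exp (C * suminf a * norm z powr \<sigma>)" for z
      using partial by (intro tendsto_upperbound[OF tendsto_norm[OF partial_prod_tendsto]]) auto
  qed
qed

text \<open>
  For an exponent \<open>\<sigma>\<close> strictly between \<open>s\<close> and \<open>s + e\<close>, the polynomial factor and the constant \<open>B\<close> of
  \<open>norm_limit_le\<close> are swallowed by \<open>exp (|z| powr (s + e))\<close>.
\<close>
lemma order_of_growth_limit_le: "order_of_growth F \<le> ereal s"
proof (rule ereal_le_epsilon2)
  fix e :: real assume "e > 0"
  define \<sigma> where "\<sigma> = s + min 1 (e / 2)"
  have \<sigma>: "s < \<sigma>" "\<sigma> \<le> s + 1" "\<sigma> < s + e" "\<sigma> > 0" "s + e > 0"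
    using \<open>e > 0\<close> s_pos by (auto simp: \<sigma>_def)
  obtain B where B: "B > 0"
    "\<And>z. norm (F z) \<le> norm (initial_poly lam N z) * exp (B * norm z powr \<sigma>)"
    using norm_limit_le[OF \<sigma>(1,2)] by blast
  define A where "A = 3 / 2 * (2 * lam) ^ (2 ^ N - 1)"
  define m :: nat where "m = 2 ^ N"
  have "A > 0" using lam_ge by (simp add: A_def)
  then have "\<forall>\<^sub>F r in at_top. A * r ^ m * exp (B * r powr \<sigma>) \<le> exp (r powr (s + e))"
    using B(1) \<sigma> by real_asymp
  then have "\<forall>\<^sub>F z in at_infinity.
      A * norm (z::complex) ^ m * exp (B * norm z powr \<sigma>) \<le> exp (norm z powr (s + e))"
    using filterlim_norm_at_top by (rule eventually_compose_filterlim)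
  moreover have "\<forall>\<^sub>F z::complex in at_infinity. norm z \<ge> R"
    unfolding eventually_at_infinity by blast
  ultimately have "\<forall>\<^sub>F z in at_infinity. norm (F z) \<le> exp (norm z powr (s + e))"
  proof eventually_elim
    case (elim z)
    have "norm (F z) \<le> norm (initial_poly lam N z) * exp (B * norm z powr \<sigma>)" by (rule B)
    also have "\<dots> \<le> A * norm z ^ m * exp (B * norm z powr \<sigma>)"
      unfolding A_def m_def using elim by (intro mult_right_mono initial_poly_bounds) auto
    finally show ?case using elim by linarith
  qed
  then show "order_of_growth F \<le> ereal s + ereal e"
    using order_of_growth_leI[of F "s + e"] by simp
qed

text \<open>
  Along the points \<open>2 \<rho> k\<close> the limit has modulus at least \<open>2 ^ n k\<close>, where \<open>n k > \<rho> k powr s - 1\<close>; the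
  constants 2 and \<open>ln 2\<close> are harmless for an exponent \<open>\<sigma> < s\<close>.
\<close>
lemma order_of_growth_limit_ge: "ereal s \<le> order_of_growth F"
proof (rule dense_le)
  fix c assume "c < ereal s"
  then obtain \<sigma> where \<sigma>: "c < ereal \<sigma>" "\<sigma> < s"
    using ereal_dense2[of c "ereal s"] by auto
  have "ereal \<sigma> \<le> order_of_growth F"
  proof (rule order_of_growth_geI)
    let ?\<zeta> = "\<lambda>k. complex_of_real (2 * \<rho> k)"
    have "filterlim (\<lambda>k. 2 * \<rho> k) at_top sequentially"
      by (rule filterlim_tendsto_pos_mult_at_top[OF tendsto_const _ filterlim_radius]) simp
    then show "filterlim ?\<zeta> at_infinity sequentially"
      by (rule filterlim_compose[OF filterlim_of_real_at_infinity])
    have "\<forall>\<^sub>F r in at_top. (2 * r) powr \<sigma> \<le> ln 2 * (r powr s - 1)"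
      using s_pos \<sigma>(2) by real_asymp
    then have "\<forall>\<^sub>F k in sequentially. (2 * \<rho> k) powr \<sigma> \<le> ln 2 * (\<rho> k powr s - 1)"
      using filterlim_radius by (rule eventually_compose_filterlim)
    then show "\<forall>\<^sub>F k in sequentially. exp (norm (?\<zeta> k) powr \<sigma>) \<le> norm (F (?\<zeta> k))"
      using eventually_ge_at_top[of 1]
    proof eventually_elim
      case (elim k)
      have norm_\<zeta>: "norm (?\<zeta> k) = 2 * \<rho> k"
        using radius_pos[OF elim(2)] by simp
      have "norm (?\<zeta> k) powr \<sigma> \<le> ln 2 * (\<rho> k powr s - 1)" using elim norm_\<zeta> by simp
      also have "\<dots> \<le> ln 2 * real (n k)"
        using exponent_bounds[OF elim(2)] by (intro mult_left_mono) auto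
      finally have "exp (norm (?\<zeta> k) powr \<sigma>) \<le> exp (ln 2 * real (n k))" by simp
      also have "\<dots> = 2 ^ n k" by (simp add: mult.commute[of "ln 2"] exp_of_nat_mult)
      also have "\<dots> \<le> norm (F (?\<zeta> k))" by (rule norm_limit_ge[OF elim(2) norm_\<zeta>])
      finally show ?case .
    qed
  qed
  then show "c \<le> order_of_growth F" using \<sigma>(1) by order
qed

lemma order_of_growth_limit: "order_of_growth F = ereal s"
  by (intro antisym order_of_growth_limit_le order_of_growth_limit_ge)

lemma transcendental_entire_limit: "transcendental_entire F"
  using holomorphic_limit order_of_growth_limit s_pos by (rule transcendental_entire_if_order_pos)

end

section \<open>Exponents prescribed by a function of the radii\<close>

text \<open>
  The \<open>k\<close>-th radius is determined by the exponents with index less than \<open>k\<close>; this is what makes a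
  recursive choice of the exponents possible.
\<close>
lemma radius_partial_prod_cong:
  "(\<And>j. j < k \<Longrightarrow> n j = n' j) \<Longrightarrow> radius lam N R n k = radius lam N R n' k"
  "(\<And>j. j \<le> k \<Longrightarrow> n j = n' j) \<Longrightarrow> partial_prod lam N R n k z = partial_prod lam N R n' k z"
proof (induction lam N R n k and lam N R n k z rule: radius_partial_prod.induct)
  case (3 lam N R n k)
  then show ?case
    by (auto simp: less_Suc_eq_le simp del: partial_prod.simps(2) intro!: SUP_cong)
qed (auto simp: less_Suc_eq_le)

text \<open>
  The sequence is the diagonal of successive approximations \<open>g k\<close>, where \<open>g (Suc k)\<close> changes \<open>g k\<close> only
  at index \<open>Suc k\<close>. The radius with that index is already final for \<open>g k\<close>.
\<close>
lemma exponents_exist: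
  fixes e :: "real \<Rightarrow> nat"
  shows "\<exists>n. \<forall>k\<ge>1. n k = e (radius lam N R n k)"
proof -
  define g where "g = rec_nat (\<lambda>_. 0 :: nat)
    (\<lambda>k h. h(Suc k := e (radius lam N R h (Suc k))))"
  define n where "n k = g k k" for k
  have g_Suc: "g (Suc k) = (g k)(Suc k := e (radius lam N R (g k) (Suc k)))" for k
    by (simp add: g_def)
  have stable: "g (k + d) j = g k j" if "j \<le> k" for k d j
    using that by (induction d) (auto simp: g_Suc)
  have "n (Suc k) = e (radius lam N R n (Suc k))" for k
  proof -
    have "n j = g k j" if "j < Suc k" for j
      using stable[of j j "k - j"] that by (simp add: n_def)
    then have "radius lam N R n (Suc k) = radius lam N R (g k) (Suc k)"
      by (rule radius_partial_prod_cong)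
    then show ?thesis by (simp add: n_def g_Suc)
  qed
  then show ?thesis by (intro exI[of _ n] allI impI) (metis Suc_le_D One_nat_def)
qed

theorem theorem4p2:
  fixes lam s :: real and N :: nat
  assumes "lam \<ge> 1" and "N \<ge> 4" and "s > 0"
  shows "(\<forall>\<^sub>F R in at_top. \<exists>n f.
            family_member lam N R n f \<and> transcendental_entire f \<and> order_of_growth f = ereal s) \<and>
         (\<forall>\<^sub>F R in at_top.
            (\<exists>n. \<forall>k\<ge>1. int (n k) = \<lfloor>radius lam N R n k powr s\<rfloor>) \<and>
            (\<forall>n. (\<forall>k\<ge>1. int (n k) = \<lfloor>radius lam N R n k powr s\<rfloor>) \<longrightarrow>
               (\<exists>f. family_member lam N R n f \<and> transcendental_entire f \<and>
                    order_of_growth f = ereal s)))"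
proof -
  have "\<forall>\<^sub>F R in at_top. (2 * R) powr s \<ge> s + 9" using assms(3) by real_asymp
  then have "\<forall>\<^sub>F R in at_top.
      (\<exists>n. \<forall>k\<ge>1. int (n k) = \<lfloor>radius lam N R n k powr s\<rfloor>) \<and>
      (\<forall>n. (\<forall>k\<ge>1. int (n k) = \<lfloor>radius lam N R n k powr s\<rfloor>) \<longrightarrow>
         (\<exists>f. family_member lam N R n f \<and> transcendental_entire f \<and>
              order_of_growth f = ereal s))"
    using eventually_initial_poly_bounds[OF assms(1), of N] eventually_ge_at_top[of 32]
  proof eventually_elim
    case (elim R)
    obtain n where "\<forall>k\<ge>1. n k = nat \<lfloor>radius lam N R n k powr s\<rfloor>"
      using exponents_exist[of "\<lambda>r. nat \<lfloor>r powr s\<rfloor>"] by blast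
    then have "\<forall>k\<ge>1. int (n k) = \<lfloor>radius lam N R n k powr s\<rfloor>" by simp
    moreover have "\<exists>f. family_member lam N R n f \<and> transcendental_entire f \<and>
        order_of_growth f = ereal s"
      if "\<forall>k\<ge>1. int (n k) = \<lfloor>radius lam N R n k powr s\<rfloor>" for n
    proof -
      interpret power_family lam R s N n
        by unfold_locales (use assms elim that in auto)
      show ?thesis
        using family_member_limit transcendental_entire_limit order_of_growth_limit by blast
    qed
    ultimately show ?case by blast
  qed
  moreover from this have "\<forall>\<^sub>F R in at_top. \<exists>n f.
      family_member lam N R n f \<and> transcendental_entire f \<and> order_of_growth f = ereal s"
    by (rule eventually_mono) blast
  ultimately show ?thesis by blast
qed

end
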